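(* Let $g$ be a complex vector space, let $[\ ,\ ]:g\otimes g\to g$ be a linear map, and let $V=\mathbb{C}\oplus g$, with $1\in\mathbb{C}\subset V$. Define the linear map $\Psi:V\otimes V\to V\otimes V$ by $$\Psi(1\otimes 1)=1\otimes 1,\quad \Psi(1\otimes\xi)=\xi\otimes 1,\quad \Psi(\xi\otimes 1)=1\otimes\xi,\quad \Psi(\xi\otimes\eta)=\eta\otimes\xi+[\xi,\eta]\otimes 1\qquad \forall\,\xi,\eta\in g.$$ Then: (i) $\Psi$ is a braiding if and only if $[\ ,\ ]$ obeys the Jacobi identity $[\xi,[\eta,\zeta]]=[[\xi,\eta],\zeta]+[\eta,[\xi,\zeta]]$ for all $\xi,\eta,\zeta\in g$. (ii) $\Psi$ has minimal polynomial $(\Psi^2-\mathrm{id})(\Psi+\mathrm{id})=0$ (that is, the minimal polynomial of $\Psi$ is $(x^2-1)(x+1)$) if and only if $[\ ,\ ]$ is non-zero and antisymmetric (that is, $[\xi,\eta]=-[\eta,\xi]$ for all $\xi,\eta\in g$).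
   Context: A braiding on a vector space $V$ is a linear map $\Psi:V\otimes V\to V\otimes V$ such that $\Psi_{23}\circ\Psi_{12}\circ\Psi_{23}=\Psi_{12}\circ\Psi_{23}\circ\Psi_{12}$ on $V\otimes V\otimes V$, where $\Psi_{12}=\Psi\otimes\mathrm{id}$ and $\Psi_{23}=\mathrm{id}\otimes\Psi$. *)

theory Defs
  imports
    "HOL-Library.Product_Plus"
    "HOL-Library.Poly_Mapping"
    "HOL-Computational_Algebra.Polynomial"
begin

section \<open>Complex vector spaces\<close>

class scaleC =
  fixes scaleC :: "complex \<Rightarrow> 'a \<Rightarrow> 'a"  (infixr \<open>*\<^sub>C\<close> 75)

class complex_vector = scaleC + ab_group_add +
  assumes scaleC_add_right: "a *\<^sub>C (x + y) = a *\<^sub>C x + a *\<^sub>C y"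
    and scaleC_add_left: "(a + b) *\<^sub>C x = a *\<^sub>C x + b *\<^sub>C x"
    and scaleC_scaleC: "a *\<^sub>C b *\<^sub>C x = (a * b) *\<^sub>C x"
    and scaleC_one: "1 *\<^sub>C x = x"

global_interpretation complex_vector:
  vector_space "scaleC :: complex \<Rightarrow> 'a \<Rightarrow> 'a::complex_vector"
  by unfold_locales (rule scaleC_add_right scaleC_add_left scaleC_scaleC scaleC_one)+

abbreviation clinear :: "('a::complex_vector \<Rightarrow> 'b::complex_vector) \<Rightarrow> bool" where
  "clinear \<equiv> Vector_Spaces.linear (*\<^sub>C) (*\<^sub>C)"

lemma clinear_iff:
  "clinear f \<longleftrightarrow> (\<forall>x y. f (x + y) = f x + f y) \<and> (\<forall>c x. f (c *\<^sub>C x) = c *\<^sub>C f x)"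
  by (auto simp: Vector_Spaces.linear_def module_hom_def module_hom_axioms_def
      complex_vector.vector_space_axioms complex_vector.module_axioms)

definition bilinear :: "('a::complex_vector \<Rightarrow> 'b::complex_vector \<Rightarrow> 'c::complex_vector) \<Rightarrow> bool" where
  "bilinear b \<longleftrightarrow> (\<forall>y. clinear (\<lambda>x. b x y)) \<and> (\<forall>x. clinear (b x))"

lemma bilinearD:
  assumes "bilinear b"
  shows "b (x + x') y = b x y + b x' y" "b (c *\<^sub>C x) y = c *\<^sub>C b x y"
    "b x (y + y') = b x y + b x y'" "b x (c *\<^sub>C y) = c *\<^sub>C b x y"
  using assms unfolding bilinear_def clinear_iff by blast+

instantiation complex :: complex_vector
begin
definition "scaleC_complex = ((*) :: complex \<Rightarrow> _)"
instance by standard (auto simp: scaleC_complex_def algebra_simps)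
end

instantiation prod :: (complex_vector, complex_vector) complex_vector
begin
definition "scaleC_prod c p = (c *\<^sub>C fst p, c *\<^sub>C snd p)"
instance
  by standard (auto simp: scaleC_prod_def scaleC_add_right scaleC_add_left scaleC_scaleC scaleC_one)
end

lemma scaleC_Pair [simp]: "c *\<^sub>C (x, y) = (c *\<^sub>C x, c *\<^sub>C y)"
  and fst_scaleC [simp]: "fst (c *\<^sub>C p) = c *\<^sub>C fst p"
  and snd_scaleC [simp]: "snd (c *\<^sub>C p) = c *\<^sub>C snd p"
  by (simp_all add: scaleC_prod_def)

instantiation poly_mapping :: (type, complex_vector) complex_vector
begin
definition "scaleC_poly_mapping c p = Poly_Mapping.map (scaleC c) p"

lemma lookup_scaleC: "Poly_Mapping.lookup (c *\<^sub>C p) k = c *\<^sub>C Poly_Mapping.lookup p k"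
  by (simp add: scaleC_poly_mapping_def map.rep_eq when_def)

instance
  by standard (auto intro!: poly_mapping_eqI simp: lookup_scaleC lookup_add
      scaleC_add_right scaleC_add_left scaleC_scaleC scaleC_one)
end


section \<open>Tensor products over the complex numbers\<close>

text \<open>
  The tensor product is the free vector space on \<open>'a \<times> 'b\<close> (finitely supported functions)
  modulo the subspace spanned by the bilinearity relations.
\<close>

definition tensor_relators :: "(('a::complex_vector \<times> 'b::complex_vector) \<Rightarrow>\<^sub>0 complex) set" where
  "tensor_relators =
     {Poly_Mapping.single (x + x', y) 1 - Poly_Mapping.single (x, y) 1
        - Poly_Mapping.single (x', y) 1 | x x' y. True} \<union>
     {Poly_Mapping.single (x, y + y') 1 - Poly_Mapping.single (x, y) 1
        - Poly_Mapping.single (x, y') 1 | x y y'. True} \<union>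
     {Poly_Mapping.single (c *\<^sub>C x, y) 1 - c *\<^sub>C Poly_Mapping.single (x, y) 1 | c x y. True} \<union>
     {Poly_Mapping.single (x, c *\<^sub>C y) 1 - c *\<^sub>C Poly_Mapping.single (x, y) 1 | c x y. True}"

definition tensor_rel ::
  "(('a::complex_vector \<times> 'b::complex_vector) \<Rightarrow>\<^sub>0 complex) \<Rightarrow> (('a \<times> 'b) \<Rightarrow>\<^sub>0 complex) \<Rightarrow> bool"
where "tensor_rel p q \<longleftrightarrow> p - q \<in> complex_vector.span tensor_relators"

lemma equivp_tensor_rel:
  "equivp (tensor_rel :: (('a::complex_vector \<times> 'b::complex_vector) \<Rightarrow>\<^sub>0 complex) \<Rightarrow> _)"
proof (rule equivpI)
  show "reflp (tensor_rel :: (('a \<times> 'b) \<Rightarrow>\<^sub>0 complex) \<Rightarrow> _)"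
    by (auto intro!: reflpI simp: tensor_rel_def complex_vector.span_zero)
  show "symp (tensor_rel :: (('a \<times> 'b) \<Rightarrow>\<^sub>0 complex) \<Rightarrow> _)"
    by (rule sympI) (metis complex_vector.span_neg minus_diff_eq tensor_rel_def)
  show "transp (tensor_rel :: (('a \<times> 'b) \<Rightarrow>\<^sub>0 complex) \<Rightarrow> _)"
  proof (rule transpI)
    fix p q r :: "('a \<times> 'b) \<Rightarrow>\<^sub>0 complex"
    assume "tensor_rel p q" "tensor_rel q r"
    then show "tensor_rel p r"
      using complex_vector.span_add[of "p - q" _ "q - r"] by (simp add: tensor_rel_def)
  qed
qed

quotient_type (overloaded) ('a, 'b) tensor (infixr \<open>\<otimes>\<^sub>C\<close> 70) =
  "('a::complex_vector \<times> 'b::complex_vector) \<Rightarrow>\<^sub>0 complex" / tensor_rel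
  by (rule equivp_tensor_rel)

instantiation tensor :: (complex_vector, complex_vector) complex_vector
begin

lift_definition zero_tensor :: "('a, 'b) tensor" is 0 .

lift_definition plus_tensor :: "('a, 'b) tensor \<Rightarrow> ('a, 'b) tensor \<Rightarrow> ('a, 'b) tensor" is "(+)"
  unfolding tensor_rel_def by (metis add_diff_add complex_vector.span_add)

lift_definition minus_tensor :: "('a, 'b) tensor \<Rightarrow> ('a, 'b) tensor \<Rightarrow> ('a, 'b) tensor" is "(-)"
proof (unfold tensor_rel_def)
  fix p p' q q' :: "('a \<times> 'b) \<Rightarrow>\<^sub>0 complex"
  assume "p - p' \<in> complex_vector.span tensor_relators" "q - q' \<in> complex_vector.span tensor_relators"
  from complex_vector.span_diff[OF this]
  show "p - q - (p' - q') \<in> complex_vector.span tensor_relators"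
    by (simp add: algebra_simps)
qed

lift_definition uminus_tensor :: "('a, 'b) tensor \<Rightarrow> ('a, 'b) tensor" is uminus
  unfolding tensor_rel_def
  by (metis complex_vector.span_neg minus_diff_minus)

lift_definition scaleC_tensor :: "complex \<Rightarrow> ('a, 'b) tensor \<Rightarrow> ('a, 'b) tensor" is scaleC
  unfolding tensor_rel_def
  by (metis complex_vector.scale_right_diff_distrib complex_vector.span_scale)

instance
  by standard
    (transfer; simp add: tensor_rel_def complex_vector.span_zero algebra_simps
      scaleC_add_right scaleC_add_left scaleC_scaleC scaleC_one)+

end

lift_definition tensor_pure :: "'a::complex_vector \<Rightarrow> 'b::complex_vector \<Rightarrow> ('a, 'b) tensor"
  (infixr \<open>\<otimes>\<^sub>C\<close> 70) is "\<lambda>x y. Poly_Mapping.single (x, y) 1" .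

lemma bilinear_tensor_pure: "bilinear (\<otimes>\<^sub>C)"
  unfolding bilinear_def clinear_iff
proof (safe)
  fix x x' :: 'a and y y' :: 'b and c :: complex
  show "(x + x') \<otimes>\<^sub>C y = x \<otimes>\<^sub>C y + x' \<otimes>\<^sub>C y"
    by transfer
      (unfold tensor_rel_def diff_diff_add[symmetric], rule complex_vector.span_base,
        unfold tensor_relators_def, blast)
  show "x \<otimes>\<^sub>C (y + y') = x \<otimes>\<^sub>C y + x \<otimes>\<^sub>C y'"
    by transfer
      (unfold tensor_rel_def diff_diff_add[symmetric], rule complex_vector.span_base,
        unfold tensor_relators_def, blast)
  show "(c *\<^sub>C x) \<otimes>\<^sub>C y = c *\<^sub>C (x \<otimes>\<^sub>C y)"
    by transfer
      (unfold tensor_rel_def, rule complex_vector.span_base, unfold tensor_relators_def, blast)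
  show "x \<otimes>\<^sub>C (c *\<^sub>C y) = c *\<^sub>C (x \<otimes>\<^sub>C y)"
    by transfer
      (unfold tensor_rel_def, rule complex_vector.span_base, unfold tensor_relators_def, blast)
qed

lemmas tensor_pure_simps = bilinearD[OF bilinear_tensor_pure]

definition free_extend ::
  "('a::complex_vector \<Rightarrow> 'b::complex_vector \<Rightarrow> 'c::complex_vector) \<Rightarrow> (('a \<times> 'b) \<Rightarrow>\<^sub>0 complex) \<Rightarrow> 'c"
where
  "free_extend b p = (\<Sum>k\<in>Poly_Mapping.keys p. Poly_Mapping.lookup p k *\<^sub>C b (fst k) (snd k))"

lemma free_extend_superset:
  assumes "finite A" "Poly_Mapping.keys p \<subseteq> A"
  shows "free_extend b p = (\<Sum>k\<in>A. Poly_Mapping.lookup p k *\<^sub>C b (fst k) (snd k))"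
  unfolding free_extend_def
  by (rule sum.mono_neutral_left) (use assms in \<open>auto simp: in_keys_iff\<close>)

lemma free_extend_single: "free_extend b (Poly_Mapping.single (x, y) c) = c *\<^sub>C b x y"
  by (subst free_extend_superset[of "{(x, y)}"]) auto

lemma clinear_free_extend: "clinear (free_extend b)"
  unfolding clinear_iff
proof (safe)
  fix p q :: "('a \<times> 'b) \<Rightarrow>\<^sub>0 complex" and c
  let ?A = "Poly_Mapping.keys p \<union> Poly_Mapping.keys q"
  have "free_extend b (p + q) = (\<Sum>k\<in>?A. Poly_Mapping.lookup (p + q) k *\<^sub>C b (fst k) (snd k))"
    by (rule free_extend_superset) (simp_all add: keys_add)
  moreover have "free_extend b p = (\<Sum>k\<in>?A. Poly_Mapping.lookup p k *\<^sub>C b (fst k) (snd k))"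
    by (rule free_extend_superset) auto
  moreover have "free_extend b q = (\<Sum>k\<in>?A. Poly_Mapping.lookup q k *\<^sub>C b (fst k) (snd k))"
    by (rule free_extend_superset) auto
  ultimately show "free_extend b (p + q) = free_extend b p + free_extend b q"
    by (simp add: lookup_add scaleC_add_left sum.distrib)
  have "free_extend b (c *\<^sub>C p) =
      (\<Sum>k\<in>Poly_Mapping.keys p. Poly_Mapping.lookup (c *\<^sub>C p) k *\<^sub>C b (fst k) (snd k))"
    by (rule free_extend_superset) (auto simp: in_keys_iff lookup_scaleC)
  then show "free_extend b (c *\<^sub>C p) = c *\<^sub>C free_extend b p"
    by (simp add: free_extend_def lookup_scaleC scaleC_complex_def
        complex_vector.scale_sum_right scaleC_scaleC)
qed

lemma clinear_diff: "clinear f \<Longrightarrow> f (x - y) = f x - f y"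
  by (metis clinear_iff add_diff_cancel diff_add_cancel)

lemma free_extend_relators:
  assumes "bilinear b" "p \<in> complex_vector.span tensor_relators"
  shows "free_extend b p = 0"
  using assms(2)
proof (induction rule: complex_vector.span_induct_alt)
  case base
  show ?case by (simp add: free_extend_def)
next
  case (step c r q)
  have "free_extend b r = 0"
    using step(1) unfolding tensor_relators_def
    by (auto simp: clinear_diff[OF clinear_free_extend] free_extend_single scaleC_one
        bilinearD[OF assms(1)] clinear_free_extend[unfolded clinear_iff])
  with step show ?case
    by (simp add: clinear_free_extend[unfolded clinear_iff])
qed

text \<open>
  The linear map out of the tensor product induced by a bilinear map; the choice of
  representative is immaterial only for bilinear arguments.
\<close>

definition tensor_lift ::
  "('a::complex_vector \<Rightarrow> 'b::complex_vector \<Rightarrow> 'c::complex_vector) \<Rightarrow> ('a, 'b) tensor \<Rightarrow> 'c" where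
  "tensor_lift b t = free_extend b (rep_tensor t)"

lemma tensor_lift_abs:
  assumes "bilinear b"
  shows "tensor_lift b (abs_tensor p) = free_extend b p"
proof -
  have "tensor_rel (rep_tensor (abs_tensor p)) p"
    using Quotient_tensor by (metis Quotient_rep_abs equivp_reflp equivp_tensor_rel)
  then have "free_extend b (rep_tensor (abs_tensor p) - p) = 0"
    unfolding tensor_rel_def by (rule free_extend_relators[OF assms])
  then show ?thesis
    by (simp add: tensor_lift_def clinear_diff[OF clinear_free_extend])
qed

lemma tensor_lift_pure:
  assumes "bilinear b"
  shows "tensor_lift b (x \<otimes>\<^sub>C y) = b x y"
  by (simp add: tensor_pure.abs_eq tensor_lift_abs[OF assms] free_extend_single scaleC_one)

lemma clinear_tensor_lift:
  assumes "bilinear b"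
  shows "clinear (tensor_lift b)"
  unfolding clinear_iff
proof (safe)
  fix s t :: "('a, 'b) tensor" and c
  obtain p q where [simp]: "s = abs_tensor p" "t = abs_tensor q"
    by (metis Quotient_tensor Quotient_abs_rep)
  show "tensor_lift b (s + t) = tensor_lift b s + tensor_lift b t"
    by (simp add: plus_tensor.abs_eq tensor_lift_abs[OF assms]
        clinear_free_extend[unfolded clinear_iff])
  show "tensor_lift b (c *\<^sub>C s) = c *\<^sub>C tensor_lift b s"
    by (simp add: scaleC_tensor.abs_eq tensor_lift_abs[OF assms]
        clinear_free_extend[unfolded clinear_iff])
qed

lemma abs_tensor_eq_sum:
  "abs_tensor p =
    (\<Sum>k\<in>Poly_Mapping.keys p. Poly_Mapping.lookup p k *\<^sub>C (fst k \<otimes>\<^sub>C snd k))"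
proof -
  have lin: "clinear abs_tensor"
    by (simp add: clinear_iff plus_tensor.abs_eq scaleC_tensor.abs_eq)
  have "p = free_extend (\<lambda>x y. Poly_Mapping.single (x, y) 1) p"
    by (rule poly_mapping_eqI)
      (auto simp: free_extend_def lookup_sum lookup_scaleC lookup_single when_def
        scaleC_complex_def in_keys_iff if_distrib cong: if_cong)
  then have "abs_tensor p = abs_tensor (free_extend (\<lambda>x y. Poly_Mapping.single (x, y) 1) p)"
    by simp
  also have "\<dots> = (\<Sum>k\<in>Poly_Mapping.keys p. abs_tensor
      (Poly_Mapping.lookup p k *\<^sub>C Poly_Mapping.single (fst k, snd k) 1))"
    unfolding free_extend_def
    by (rule module_hom.sum[OF lin[folded module_hom_iff_linear]])
  finally show ?thesis
    by (simp add: scaleC_tensor.abs_eq[symmetric] tensor_pure.abs_eq)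
qed

lemma tensor_induct [case_names zero add scale pure]:
  assumes "P 0" "\<And>s t. P s \<Longrightarrow> P t \<Longrightarrow> P (s + t)" "\<And>c t. P t \<Longrightarrow> P (c *\<^sub>C t)"
    "\<And>x y. P (x \<otimes>\<^sub>C y)"
  shows "P t"
proof -
  obtain p where t: "t = abs_tensor p"
    by (rule that[of "rep_tensor t"]) (simp add: Quotient_abs_rep[OF Quotient_tensor])
  have "P (\<Sum>k\<in>A. f k *\<^sub>C (fst k \<otimes>\<^sub>C snd k))" if "finite A" for A f
    using that by (induction A) (simp_all add: assms)
  then show ?thesis
    unfolding t abs_tensor_eq_sum by simp
qed

lemma clinear_tensor_eqI:
  assumes "clinear f" "clinear g" "\<And>x y. f (x \<otimes>\<^sub>C y) = g (x \<otimes>\<^sub>C y)"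
  shows "f = g"
proof
  have *: "clinear h \<Longrightarrow> h 0 = 0" for h :: "('a, 'b) tensor \<Rightarrow> 'c"
    using clinear_diff[of h 0 0] by simp
  show "f t = g t" for t
    by (induction t rule: tensor_induct)
      (use assms in \<open>simp_all add: * assms(3) assms(1,2)[unfolded clinear_iff]\<close>)
qed

definition tensor_map ::
  "('a::complex_vector \<Rightarrow> 'c::complex_vector) \<Rightarrow> ('b::complex_vector \<Rightarrow> 'd::complex_vector)
    \<Rightarrow> ('a, 'b) tensor \<Rightarrow> ('c, 'd) tensor" where
  "tensor_map f g = tensor_lift (\<lambda>x y. f x \<otimes>\<^sub>C g y)"

lemma
  assumes "clinear f" "clinear g"
  shows tensor_map_pure: "tensor_map f g (x \<otimes>\<^sub>C y) = f x \<otimes>\<^sub>C g y"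
    and clinear_tensor_map: "clinear (tensor_map f g)"
proof -
  have "bilinear (\<lambda>x y. f x \<otimes>\<^sub>C g y)"
    using assms by (simp add: bilinear_def clinear_iff tensor_pure_simps)
  then show "tensor_map f g (x \<otimes>\<^sub>C y) = f x \<otimes>\<^sub>C g y" "clinear (tensor_map f g)"
    unfolding tensor_map_def by (rule tensor_lift_pure clinear_tensor_lift)+
qed

definition tensor_assoc ::
  "(('a::complex_vector, 'b::complex_vector) tensor, 'c::complex_vector) tensor
    \<Rightarrow> ('a, ('b, 'c) tensor) tensor" where
  "tensor_assoc = tensor_lift (\<lambda>t z. tensor_lift (\<lambda>x y. x \<otimes>\<^sub>C (y \<otimes>\<^sub>C z)) t)"

definition tensor_unassoc ::
  "('a::complex_vector, ('b::complex_vector, 'c::complex_vector) tensor) tensor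
    \<Rightarrow> (('a, 'b) tensor, 'c) tensor" where
  "tensor_unassoc = tensor_lift (\<lambda>x. tensor_lift (\<lambda>y z. (x \<otimes>\<^sub>C y) \<otimes>\<^sub>C z))"

lemma bilinear_assoc_aux: "bilinear (\<lambda>x y. x \<otimes>\<^sub>C (y \<otimes>\<^sub>C z))"
  by (simp add: bilinear_def clinear_iff tensor_pure_simps)

lemma assoc_aux_add:
  "tensor_lift (\<lambda>x y. x \<otimes>\<^sub>C (y \<otimes>\<^sub>C (z + z'))) t =
    tensor_lift (\<lambda>x y. x \<otimes>\<^sub>C (y \<otimes>\<^sub>C z)) t + tensor_lift (\<lambda>x y. x \<otimes>\<^sub>C (y \<otimes>\<^sub>C z')) t"
  by (rule clinear_tensor_eqI[THEN fun_cong, OF clinear_tensor_lift[OF bilinear_assoc_aux]])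
    (simp add: clinear_iff clinear_tensor_lift[OF bilinear_assoc_aux, unfolded clinear_iff] algebra_simps
       scaleC_add_right scaleC_scaleC,
     simp only: tensor_lift_pure[OF bilinear_assoc_aux], simp only: tensor_pure_simps)

lemma assoc_aux_scale:
  "tensor_lift (\<lambda>x y. x \<otimes>\<^sub>C (y \<otimes>\<^sub>C (c *\<^sub>C z))) t =
    c *\<^sub>C tensor_lift (\<lambda>x y. x \<otimes>\<^sub>C (y \<otimes>\<^sub>C z)) t"
  by (rule clinear_tensor_eqI[THEN fun_cong, OF clinear_tensor_lift[OF bilinear_assoc_aux]])
    (simp add: clinear_iff clinear_tensor_lift[OF bilinear_assoc_aux, unfolded clinear_iff] algebra_simps
       scaleC_add_right scaleC_scaleC,
     simp only: tensor_lift_pure[OF bilinear_assoc_aux], simp only: tensor_pure_simps)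

lemma bilinear_assoc:
  "bilinear (\<lambda>t z. tensor_lift (\<lambda>x y. x \<otimes>\<^sub>C (y \<otimes>\<^sub>C z)) t)"
  unfolding bilinear_def clinear_iff
  by (simp only: assoc_aux_add assoc_aux_scale
      clinear_tensor_lift[OF bilinear_assoc_aux, unfolded clinear_iff]) simp

lemma
  shows tensor_assoc_pure: "tensor_assoc ((x \<otimes>\<^sub>C y) \<otimes>\<^sub>C z) = x \<otimes>\<^sub>C (y \<otimes>\<^sub>C z)"
    and clinear_tensor_assoc: "clinear tensor_assoc"
  unfolding tensor_assoc_def
  by (simp_all only: tensor_lift_pure[OF bilinear_assoc] clinear_tensor_lift[OF bilinear_assoc]
      tensor_lift_pure[OF bilinear_assoc_aux])

lemma bilinear_unassoc_aux: "bilinear (\<lambda>y z. (x \<otimes>\<^sub>C y) \<otimes>\<^sub>C z)"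
  by (simp add: bilinear_def clinear_iff tensor_pure_simps)

lemma unassoc_aux_add:
  "tensor_lift (\<lambda>y z. ((x + x') \<otimes>\<^sub>C y) \<otimes>\<^sub>C z) t =
    tensor_lift (\<lambda>y z. (x \<otimes>\<^sub>C y) \<otimes>\<^sub>C z) t + tensor_lift (\<lambda>y z. (x' \<otimes>\<^sub>C y) \<otimes>\<^sub>C z) t"
  by (rule clinear_tensor_eqI[THEN fun_cong, OF clinear_tensor_lift[OF bilinear_unassoc_aux]])
    (simp add: clinear_iff clinear_tensor_lift[OF bilinear_unassoc_aux, unfolded clinear_iff] algebra_simps
       scaleC_add_right scaleC_scaleC,
     simp only: tensor_lift_pure[OF bilinear_unassoc_aux], simp only: tensor_pure_simps)

lemma unassoc_aux_scale:
  "tensor_lift (\<lambda>y z. ((c *\<^sub>C x) \<otimes>\<^sub>C y) \<otimes>\<^sub>C z) t =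
    c *\<^sub>C tensor_lift (\<lambda>y z. (x \<otimes>\<^sub>C y) \<otimes>\<^sub>C z) t"
  by (rule clinear_tensor_eqI[THEN fun_cong, OF clinear_tensor_lift[OF bilinear_unassoc_aux]])
    (simp add: clinear_iff clinear_tensor_lift[OF bilinear_unassoc_aux, unfolded clinear_iff] algebra_simps
       scaleC_add_right scaleC_scaleC,
     simp only: tensor_lift_pure[OF bilinear_unassoc_aux], simp only: tensor_pure_simps)

lemma bilinear_unassoc:
  "bilinear (\<lambda>x. tensor_lift (\<lambda>y z. (x \<otimes>\<^sub>C y) \<otimes>\<^sub>C z))"
  unfolding bilinear_def clinear_iff
  by (simp only: unassoc_aux_add unassoc_aux_scale
      clinear_tensor_lift[OF bilinear_unassoc_aux, unfolded clinear_iff]) simp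

lemma
  shows tensor_unassoc_pure: "tensor_unassoc (x \<otimes>\<^sub>C (y \<otimes>\<^sub>C z)) = (x \<otimes>\<^sub>C y) \<otimes>\<^sub>C z"
    and clinear_tensor_unassoc: "clinear tensor_unassoc"
  unfolding tensor_unassoc_def
  by (simp_all only: tensor_lift_pure[OF bilinear_unassoc] clinear_tensor_lift[OF bilinear_unassoc]
      tensor_lift_pure[OF bilinear_unassoc_aux])

lemma tensor_unassoc_assoc:
  fixes t :: "(('a::complex_vector, 'b::complex_vector) tensor, 'c::complex_vector) tensor"
  shows "tensor_unassoc (tensor_assoc t) = t"
proof -
  note lin = clinear_tensor_assoc[unfolded clinear_iff] clinear_tensor_unassoc[unfolded clinear_iff]
  have "(\<lambda>s :: ('a, 'b) tensor. tensor_unassoc (tensor_assoc (s \<otimes>\<^sub>C z))) = (\<lambda>s. s \<otimes>\<^sub>C z)" for z :: 'c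
    by (rule clinear_tensor_eqI)
      (simp_all add: clinear_iff tensor_pure_simps lin tensor_assoc_pure tensor_unassoc_pure)
  then have pure: "tensor_unassoc (tensor_assoc (s \<otimes>\<^sub>C z)) = s \<otimes>\<^sub>C z" for z :: 'c and s :: "('a, 'b) tensor"
    by (rule fun_cong)
  have "(\<lambda>t :: (('a, 'b) tensor, 'c) tensor. tensor_unassoc (tensor_assoc t)) = (\<lambda>t. t)"
    by (rule clinear_tensor_eqI) (simp_all add: clinear_iff lin pure)
  then show ?thesis
    by (rule fun_cong)
qed

lemma tensor_assoc_unassoc:
  fixes t :: "('a::complex_vector, ('b::complex_vector, 'c::complex_vector) tensor) tensor"
  shows "tensor_assoc (tensor_unassoc t) = t"
proof -
  note lin = clinear_tensor_assoc[unfolded clinear_iff] clinear_tensor_unassoc[unfolded clinear_iff]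
  have "(\<lambda>s :: ('b, 'c) tensor. tensor_assoc (tensor_unassoc (x \<otimes>\<^sub>C s))) = (\<lambda>s. x \<otimes>\<^sub>C s)" for x :: 'a
    by (rule clinear_tensor_eqI)
      (simp_all add: clinear_iff tensor_pure_simps lin tensor_assoc_pure tensor_unassoc_pure)
  then have pure: "tensor_assoc (tensor_unassoc (x \<otimes>\<^sub>C s)) = x \<otimes>\<^sub>C s" for x :: 'a and s :: "('b, 'c) tensor"
    by (rule fun_cong)
  have "(\<lambda>t :: ('a, ('b, 'c) tensor) tensor. tensor_assoc (tensor_unassoc t)) = (\<lambda>t. t)"
    by (rule clinear_tensor_eqI) (simp_all add: clinear_iff lin pure)
  then show ?thesis
    by (rule fun_cong)
qed

section \<open>Braidings\<close>

text \<open>\<open>V \<otimes> V \<otimes> V\<close> is bracketed to the left.\<close>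

definition leg12 ::
  "(('v::complex_vector, 'v) tensor \<Rightarrow> ('v, 'v) tensor)
    \<Rightarrow> (('v, 'v) tensor, 'v) tensor \<Rightarrow> (('v, 'v) tensor, 'v) tensor" where
  "leg12 \<Psi> = tensor_map \<Psi> id"

definition leg23 ::
  "(('v::complex_vector, 'v) tensor \<Rightarrow> ('v, 'v) tensor)
    \<Rightarrow> (('v, 'v) tensor, 'v) tensor \<Rightarrow> (('v, 'v) tensor, 'v) tensor" where
  "leg23 \<Psi> = tensor_unassoc \<circ> tensor_map id \<Psi> \<circ> tensor_assoc"

definition braiding :: "(('v::complex_vector, 'v) tensor \<Rightarrow> ('v, 'v) tensor) \<Rightarrow> bool" where
  "braiding \<Psi> \<longleftrightarrow> clinear \<Psi> \<and>
     leg23 \<Psi> \<circ> leg12 \<Psi> \<circ> leg23 \<Psi> = leg12 \<Psi> \<circ> leg23 \<Psi> \<circ> leg12 \<Psi>"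


section \<open>Minimal polynomials of endomorphisms\<close>

definition poly_endo :: "complex poly \<Rightarrow> ('a::complex_vector \<Rightarrow> 'a) \<Rightarrow> 'a \<Rightarrow> 'a" where
  "poly_endo p f x = (\<Sum>i\<le>degree p. coeff p i *\<^sub>C (f ^^ i) x)"

definition is_minimal_poly :: "complex poly \<Rightarrow> ('a::complex_vector \<Rightarrow> 'a) \<Rightarrow> bool" where
  "is_minimal_poly p f \<longleftrightarrow>
     lead_coeff p = 1 \<and> (\<forall>x. poly_endo p f x = 0) \<and>
     (\<forall>q. q \<noteq> 0 \<and> (\<forall>x. poly_endo q f x = 0) \<longrightarrow> degree p \<le> degree q)"


section \<open>The map attached to a bracket\<close>

text \<open>
  \<open>\<complex> \<oplus> g\<close> is the type \<open>complex \<times> 'g\<close>, with \<open>1\<close> embedded as \<open>(1, 0)\<close> and \<open>\<xi> \<in> g\<close> as \<open>(0, \<xi>)\<close>.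
  A bracket is a linear map \<open>br\<close> on \<open>g \<otimes> g\<close>, with \<open>[\<xi>, \<eta>] = br (\<xi> \<otimes>\<^sub>C \<eta>)\<close>. The values on the
  generators determine exactly one linear map (lemma \<open>ex1_bracket_map\<close> below).
\<close>

definition bracket_map ::
  "(('g::complex_vector, 'g) tensor \<Rightarrow> 'g)
    \<Rightarrow> ((complex \<times> 'g, complex \<times> 'g) tensor \<Rightarrow> (complex \<times> 'g, complex \<times> 'g) tensor) \<Rightarrow> bool" where
  "bracket_map br \<Psi> \<longleftrightarrow> clinear \<Psi> \<and>
     \<Psi> ((1, 0) \<otimes>\<^sub>C (1, 0)) = (1, 0) \<otimes>\<^sub>C (1, 0) \<and>
     (\<forall>\<xi>. \<Psi> ((1, 0) \<otimes>\<^sub>C (0, \<xi>)) = (0, \<xi>) \<otimes>\<^sub>C (1, 0)) \<and>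
     (\<forall>\<xi>. \<Psi> ((0, \<xi>) \<otimes>\<^sub>C (1, 0)) = (1, 0) \<otimes>\<^sub>C (0, \<xi>)) \<and>
     (\<forall>\<xi> \<eta>. \<Psi> ((0, \<xi>) \<otimes>\<^sub>C (0, \<eta>)) = (0, \<eta>) \<otimes>\<^sub>C (0, \<xi>) + (0, br (\<xi> \<otimes>\<^sub>C \<eta>)) \<otimes>\<^sub>C (1, 0))"

lemma ex1_bracket_map:
  fixes br :: "('g::complex_vector, 'g) tensor \<Rightarrow> 'g"
  assumes "clinear br"
  shows "\<exists>!\<Psi>. bracket_map br \<Psi>"
proof (rule ex_ex1I)
  let ?b = "\<lambda>x y :: complex \<times> 'g. y \<otimes>\<^sub>C x + (0 :: complex, br (snd x \<otimes>\<^sub>C snd y)) \<otimes>\<^sub>C (1 :: complex, 0 :: 'g)"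
  have br: "br (s + t) = br s + br t" "br (c *\<^sub>C t) = c *\<^sub>C br t" for s t c
    using assms by (simp_all add: clinear_iff)
  have br0: "br 0 = 0"
    by (metis assms clinear_diff diff_self)
  have split: "(0 :: complex, x + y) = (0, x) + (0, y)" "(0 :: complex, c *\<^sub>C x) = c *\<^sub>C (0, x)"
    for x y :: 'g and c
    by (simp_all add: scaleC_complex_def)
  have z: "0 \<otimes>\<^sub>C y = 0" "x \<otimes>\<^sub>C 0 = 0" for x :: "'a::complex_vector" and y :: "'b::complex_vector"
    using tensor_pure_simps(2)[of 0 0 y] tensor_pure_simps(4)[of x 0 0] by simp_all
  have "bilinear ?b"
    unfolding bilinear_def clinear_iff
    by (simp add: tensor_pure_simps br split scaleC_add_right
        del: add_Pair scaleC_Pair)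
  note lift = tensor_lift_pure[OF this] clinear_tensor_lift[OF this]
  have "bracket_map br (tensor_lift ?b)"
    unfolding bracket_map_def by (simp add: lift br0 z zero_prod_def[symmetric])
  then show "\<exists>\<Psi>. bracket_map br \<Psi>" by (rule exI[of "bracket_map br"])
next
  fix \<Psi> \<Phi>
  assume P: "bracket_map br \<Psi>" "bracket_map br \<Phi>"
  show "\<Psi> = \<Phi>"
  proof (rule clinear_tensor_eqI)
    show lin: "clinear \<Psi>" "clinear \<Phi>"
      using P by (simp_all add: bracket_map_def)
    fix x y :: "complex \<times> 'g"
    have decomp: "(a, \<xi>) = a *\<^sub>C (1, 0) + (0, \<xi>)" for a :: complex and \<xi> :: 'g
      by (simp add: scaleC_complex_def)
    obtain a \<xi> c \<eta> where "x = a *\<^sub>C (1, 0) + (0, \<xi>)" "y = c *\<^sub>C (1, 0) + (0, \<eta>)"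
      using decomp[of "fst x" "snd x"] decomp[of "fst y" "snd y"] by (metis prod.collapse)
    then show "\<Psi> (x \<otimes>\<^sub>C y) = \<Phi> (x \<otimes>\<^sub>C y)"
      using P lin
      by (simp add: tensor_pure_simps bracket_map_def clinear_iff del: add_Pair scaleC_Pair)
  qed
qed

end

theory Submission
  imports Defs
begin

text \<open>
  Write \<open>e = (1, 0)\<close> and extend the bracket to \<open>V\<close> by \<open>B x y = (0, [snd x, snd y])\<close>, so that
  \<open>e\<close> is central and \<open>\<Psi> (x \<otimes> y) = y \<otimes> x + B x y \<otimes> e\<close> for \<^emph>\<open>all\<close> \<open>x, y \<in> V\<close>. On \<open>x \<otimes> y \<otimes> z\<close> the
  two sides of the braid relation then differ exactly by the Jacobi defect of \<open>B\<close> tensored with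
  \<open>e \<otimes> e\<close>, and \<open>(\<Psi>\<^sup>2 - id) (\<Psi> + id)\<close> sends \<open>x \<otimes> y\<close> to \<open>s \<otimes> e + e \<otimes> s\<close> with \<open>s = B x y + B y x\<close>.
  Contraction with the projection \<open>V \<rightarrow> \<complex>\<close>, which is \<open>1\<close> on \<open>e\<close> and \<open>0\<close> on \<open>g\<close>, removes the
  factors \<open>e\<close>.
\<close>

section \<open>Linear maps on tensor products\<close>

lemma clinear_add: "clinear f \<Longrightarrow> f (x + y) = f x + f y"
  and clinear_scale: "clinear f \<Longrightarrow> f (c *\<^sub>C x) = c *\<^sub>C f x"
  by (simp_all add: clinear_iff)

lemma clinear_0: "clinear f \<Longrightarrow> f 0 = 0"
  using clinear_diff[of f 0 0] by simp

lemma clinear_id: "clinear id"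
  by (simp add: clinear_iff)

lemma clinear_comp: "clinear f \<Longrightarrow> clinear g \<Longrightarrow> clinear (g \<circ> f)"
  by (simp add: clinear_iff)

lemma clinear_pure_left: "clinear (\<lambda>x. x \<otimes>\<^sub>C y)"
  and clinear_pure_right: "clinear (\<lambda>y. x \<otimes>\<^sub>C y)"
  by (simp_all add: clinear_iff tensor_pure_simps)

lemma tensor_pure_0 [simp]: "0 \<otimes>\<^sub>C y = 0" "x \<otimes>\<^sub>C 0 = 0"
  using clinear_0[OF clinear_pure_left] clinear_0[OF clinear_pure_right] by blast+

text \<open>Fixing the third factor gives two linear maps on the inner tensor product, so equality
  on pure tensors is applied twice, inner product first.\<close>

lemma clinear_tensor3_eqI:
  assumes "clinear f" "clinear g"
    and "\<And>x y z. f ((x \<otimes>\<^sub>C y) \<otimes>\<^sub>C z) = g ((x \<otimes>\<^sub>C y) \<otimes>\<^sub>C z)"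
  shows "f = g"
proof (rule clinear_tensor_eqI[OF assms(1,2)])
  fix t z
  have "(\<lambda>t. f (t \<otimes>\<^sub>C z)) = (\<lambda>t. g (t \<otimes>\<^sub>C z))"
    by (rule clinear_tensor_eqI)
      (use assms in \<open>simp_all add: clinear_iff tensor_pure_simps\<close>)
  then show "f (t \<otimes>\<^sub>C z) = g (t \<otimes>\<^sub>C z)"
    by (rule fun_cong)
qed

text \<open>This is \<open>id\<close> tensored with \<open>\<phi>\<close>, followed by the
  identification of \<open>'a\<close> tensored with the scalars with \<open>'a\<close>.\<close>

definition contract_right ::
  "('b::complex_vector \<Rightarrow> complex) \<Rightarrow> ('a::complex_vector, 'b) tensor \<Rightarrow> 'a" where
  "contract_right \<phi> = tensor_lift (\<lambda>x y. \<phi> y *\<^sub>C x)"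

lemma
  assumes "clinear \<phi>"
  shows contract_right_pure: "contract_right \<phi> (x \<otimes>\<^sub>C y) = \<phi> y *\<^sub>C x"
    and clinear_contract_right: "clinear (contract_right \<phi>)"
proof -
  have "bilinear (\<lambda>x y. \<phi> y *\<^sub>C x)"
    using assms unfolding bilinear_def clinear_iff
    by (simp add: scaleC_add_right scaleC_add_left scaleC_scaleC scaleC_complex_def mult.commute)
  then show "contract_right \<phi> (x \<otimes>\<^sub>C y) = \<phi> y *\<^sub>C x" "clinear (contract_right \<phi>)"
    unfolding contract_right_def by (rule tensor_lift_pure clinear_tensor_lift)+
qed

text \<open>Contraction with \<open>\<phi>\<close> is a left inverse of tensoring with
  \<open>e\<close>.\<close>

lemma tensor_pure_cancel_right:
  fixes \<phi> :: "'b::complex_vector \<Rightarrow> complex"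
  assumes "clinear \<phi>" "\<phi> e = 1"
  shows "x \<otimes>\<^sub>C e = y \<otimes>\<^sub>C e \<longleftrightarrow> x = y"
  by (metis assms contract_right_pure scaleC_one)


section \<open>The braid relation\<close>

lemma clinear_leg12: "clinear \<Psi> \<Longrightarrow> clinear (leg12 \<Psi>)"
  unfolding leg12_def by (intro clinear_tensor_map clinear_id)

lemma clinear_leg23: "clinear \<Psi> \<Longrightarrow> clinear (leg23 \<Psi>)"
  unfolding leg23_def
  by (intro clinear_comp clinear_tensor_map clinear_id clinear_tensor_assoc clinear_tensor_unassoc)

lemma leg12_pure: "clinear \<Psi> \<Longrightarrow> leg12 \<Psi> ((x \<otimes>\<^sub>C y) \<otimes>\<^sub>C z) = \<Psi> (x \<otimes>\<^sub>C y) \<otimes>\<^sub>C z"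
  by (simp add: leg12_def tensor_map_pure clinear_id)

text \<open>\<open>tensor_unassoc\<close> stays in the result because the value of
  \<open>\<Psi>\<close> need not be pure; it resolves once that value is split into pure
  summands.\<close>

lemma leg23_pure:
  "clinear \<Psi> \<Longrightarrow> leg23 \<Psi> ((x \<otimes>\<^sub>C y) \<otimes>\<^sub>C z) = tensor_unassoc (x \<otimes>\<^sub>C \<Psi> (y \<otimes>\<^sub>C z))"
  by (simp add: leg23_def tensor_map_pure clinear_id tensor_assoc_pure)

text \<open>Both sides contain the reversed tensor and the same three terms with a single bracket.
  Centrality kills every bracket with \<open>e\<close>, so only the double brackets remain to be
  compared.\<close>

lemma braid_relation_pure_iff:
  fixes B :: "'v::complex_vector \<Rightarrow> 'v \<Rightarrow> 'v"
  assumes \<Psi>: "clinear \<Psi>" "\<And>x y. \<Psi> (x \<otimes>\<^sub>C y) = y \<otimes>\<^sub>C x + B x y \<otimes>\<^sub>C e"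
    and central: "\<And>x. B e x = 0" "\<And>x. B x e = 0"
  shows "(leg23 \<Psi> \<circ> leg12 \<Psi> \<circ> leg23 \<Psi>) ((x \<otimes>\<^sub>C y) \<otimes>\<^sub>C z) =
           (leg12 \<Psi> \<circ> leg23 \<Psi> \<circ> leg12 \<Psi>) ((x \<otimes>\<^sub>C y) \<otimes>\<^sub>C z) \<longleftrightarrow>
         (B x (B y z) \<otimes>\<^sub>C e) \<otimes>\<^sub>C e = ((B (B x y) z + B y (B x z)) \<otimes>\<^sub>C e) \<otimes>\<^sub>C e"
proof -
  have 12: "leg12 \<Psi> ((x \<otimes>\<^sub>C y) \<otimes>\<^sub>C z) = (y \<otimes>\<^sub>C x) \<otimes>\<^sub>C z + (B x y \<otimes>\<^sub>C e) \<otimes>\<^sub>C z" for x y z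
    by (simp add: leg12_pure \<Psi> tensor_pure_simps)
  have 23: "leg23 \<Psi> ((x \<otimes>\<^sub>C y) \<otimes>\<^sub>C z) = (x \<otimes>\<^sub>C z) \<otimes>\<^sub>C y + (x \<otimes>\<^sub>C B y z) \<otimes>\<^sub>C e" for x y z
    by (simp add: leg23_pure \<Psi> tensor_pure_simps tensor_unassoc_pure
        clinear_add[OF clinear_tensor_unassoc])
  note [simp] = 12 23 clinear_add[OF clinear_leg12[OF \<Psi>(1)]] clinear_add[OF clinear_leg23[OF \<Psi>(1)]]
  have "(leg23 \<Psi> \<circ> leg12 \<Psi> \<circ> leg23 \<Psi>) ((x \<otimes>\<^sub>C y) \<otimes>\<^sub>C z) =
      ((z \<otimes>\<^sub>C y) \<otimes>\<^sub>C x + (z \<otimes>\<^sub>C B x y) \<otimes>\<^sub>C e + (B x z \<otimes>\<^sub>C y) \<otimes>\<^sub>C e + (B y z \<otimes>\<^sub>C e) \<otimes>\<^sub>C x)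
        + (B x (B y z) \<otimes>\<^sub>C e) \<otimes>\<^sub>C e"
    by (simp add: central add_ac)
  moreover have "(leg12 \<Psi> \<circ> leg23 \<Psi> \<circ> leg12 \<Psi>) ((x \<otimes>\<^sub>C y) \<otimes>\<^sub>C z) =
      ((z \<otimes>\<^sub>C y) \<otimes>\<^sub>C x + (z \<otimes>\<^sub>C B x y) \<otimes>\<^sub>C e + (B x z \<otimes>\<^sub>C y) \<otimes>\<^sub>C e + (B y z \<otimes>\<^sub>C e) \<otimes>\<^sub>C x)
        + ((B (B x y) z + B y (B x z)) \<otimes>\<^sub>C e) \<otimes>\<^sub>C e"
    by (simp add: central tensor_pure_simps add_ac)
  ultimately show ?thesis
    by (simp only: add_left_cancel)
qed

text \<open>Both composites are linear, so pure tensors decide the braid relation; the two trailing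
  factors \<open>e\<close> are then cancelled one after the other.\<close>

lemma braiding_iff_Jacobi:
  fixes B :: "'v::complex_vector \<Rightarrow> 'v \<Rightarrow> 'v" and \<phi> :: "'v \<Rightarrow> complex"
  assumes \<Psi>: "clinear \<Psi>" "\<And>x y. \<Psi> (x \<otimes>\<^sub>C y) = y \<otimes>\<^sub>C x + B x y \<otimes>\<^sub>C e"
    and central: "\<And>x. B e x = 0" "\<And>x. B x e = 0"
    and \<phi>: "clinear \<phi>" "\<phi> e = 1"
  shows "braiding \<Psi> \<longleftrightarrow> (\<forall>x y z. B x (B y z) = B (B x y) z + B y (B x z))"
proof -
  have "braiding \<Psi> \<longleftrightarrow>
      (\<forall>x y z. (leg23 \<Psi> \<circ> leg12 \<Psi> \<circ> leg23 \<Psi>) ((x \<otimes>\<^sub>C y) \<otimes>\<^sub>C z) =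
               (leg12 \<Psi> \<circ> leg23 \<Psi> \<circ> leg12 \<Psi>) ((x \<otimes>\<^sub>C y) \<otimes>\<^sub>C z))"
  proof
    assume *: "\<forall>x y z. (leg23 \<Psi> \<circ> leg12 \<Psi> \<circ> leg23 \<Psi>) ((x \<otimes>\<^sub>C y) \<otimes>\<^sub>C z) =
        (leg12 \<Psi> \<circ> leg23 \<Psi> \<circ> leg12 \<Psi>) ((x \<otimes>\<^sub>C y) \<otimes>\<^sub>C z)"
    have "leg23 \<Psi> \<circ> leg12 \<Psi> \<circ> leg23 \<Psi> = leg12 \<Psi> \<circ> leg23 \<Psi> \<circ> leg12 \<Psi>"
      by (rule clinear_tensor3_eqI)
        (use * in \<open>intro clinear_comp clinear_leg12 clinear_leg23 \<Psi>(1) | blast\<close>)+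
    then show "braiding \<Psi>"
      using \<Psi>(1) unfolding braiding_def by blast
  qed (simp add: braiding_def)
  then show ?thesis
    unfolding braid_relation_pure_iff[of \<Psi> B e, OF \<Psi> central] tensor_pure_cancel_right[OF \<phi>] .
qed


section \<open>The minimal polynomial\<close>

text \<open>Padding with zero coefficients allows a fixed summation range when only a bound on the
  degree is known.\<close>

lemma poly_endo_eq_sum:
  assumes "degree p \<le> n"
  shows "poly_endo p f x = (\<Sum>i\<le>n. coeff p i *\<^sub>C (f ^^ i) x)"
  unfolding poly_endo_def
  by (rule sum.mono_neutral_left) (use assms in \<open>auto simp: coeff_eq_0\<close>)

lemma poly_endo_deg_le_2:
  assumes "degree p \<le> 2"
  shows "poly_endo p f x = coeff p 0 *\<^sub>C x + coeff p 1 *\<^sub>C f x + coeff p 2 *\<^sub>C f (f x)"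
  by (simp add: poly_endo_eq_sum[OF assms] eval_nat_numeral)

lemma poly_endo_cubic:
  "poly_endo [:-1, -1, 1, 1:] f x = f (f (f x)) + f (f x) - f x - x"
  by (subst poly_endo_eq_sum[of _ 3])
    (simp_all add: eval_nat_numeral scaleC_one algebra_simps)

lemma clinear_poly_endo:
  assumes "clinear f"
  shows "clinear (poly_endo p f)"
proof -
  have "clinear (f ^^ i)" for i
    by (induction i) (use assms in \<open>simp_all add: clinear_iff\<close>)
  then show ?thesis
    unfolding clinear_iff poly_endo_def
    by (simp add: scaleC_add_right sum.distrib complex_vector.scale_sum_right scaleC_scaleC mult.commute)
qed

lemma poly_endo_eq_0_iff_pure:
  assumes "clinear f"
  shows "(\<forall>t. poly_endo p f t = 0) \<longleftrightarrow> (\<forall>x y. poly_endo p f (x \<otimes>\<^sub>C y) = 0)"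
proof
  assume *: "\<forall>x y. poly_endo p f (x \<otimes>\<^sub>C y) = 0"
  have "poly_endo p f = (\<lambda>_. 0)"
    by (rule clinear_tensor_eqI) (use * in \<open>simp_all add: clinear_poly_endo assms, simp add: clinear_iff\<close>)
  then show "\<forall>t. poly_endo p f t = 0" by simp
qed blast

text \<open>The two conditions decouple: annihilation by the cubic is equivalent to antisymmetry,
  and absence of nonzero annihilators of degree below 3 to \<open>B\<close> being non-zero.\<close>

lemma minimal_poly_iff_antisymmetric:
  fixes B :: "'v::complex_vector \<Rightarrow> 'v \<Rightarrow> 'v" and \<phi> :: "'v \<Rightarrow> complex"
  assumes \<Psi>: "clinear \<Psi>" "\<And>x y. \<Psi> (x \<otimes>\<^sub>C y) = y \<otimes>\<^sub>C x + B x y \<otimes>\<^sub>C e"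
    and central: "\<And>x. B e x = 0" "\<And>x. B x e = 0"
    and \<phi>: "clinear \<phi>" "\<phi> e = 1" "\<And>x y. \<phi> (B x y) = 0"
  shows "is_minimal_poly [:-1, -1, 1, 1:] \<Psi> \<longleftrightarrow>
    (\<exists>x y. B x y \<noteq> 0) \<and> (\<forall>x y. B x y = - B y x)"
proof -
  let ?\<kappa> = "contract_right \<phi> :: ('v, 'v) tensor \<Rightarrow> 'v"
  have \<kappa> [simp]: "?\<kappa> (x \<otimes>\<^sub>C y) = \<phi> y *\<^sub>C x" "?\<kappa> (s + t) = ?\<kappa> s + ?\<kappa> t" "?\<kappa> (c *\<^sub>C t) = c *\<^sub>C ?\<kappa> t"
    "?\<kappa> 0 = 0" for x y s t c
    by (simp_all add: contract_right_pure \<phi>(1) clinear_add[OF clinear_contract_right]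
        clinear_scale[OF clinear_contract_right] clinear_0[OF clinear_contract_right])
  note [simp] = \<Psi>(2) clinear_add[OF \<Psi>(1)] central \<phi>(2,3) scaleC_one
  have \<Psi>2: "\<Psi> (\<Psi> (x \<otimes>\<^sub>C y)) = x \<otimes>\<^sub>C y + B y x \<otimes>\<^sub>C e + e \<otimes>\<^sub>C B x y" for x y
    by (simp add: add_ac)
  have cubic: "poly_endo [:-1, -1, 1, 1:] \<Psi> (x \<otimes>\<^sub>C y) = (B x y + B y x) \<otimes>\<^sub>C e + e \<otimes>\<^sub>C (B x y + B y x)"
    for x y
    unfolding poly_endo_cubic \<Psi>2 by (simp add: tensor_pure_simps algebra_simps)
  have annihilates: "(\<forall>t. poly_endo [:-1, -1, 1, 1:] \<Psi> t = 0) \<longleftrightarrow> (\<forall>x y. B x y = - B y x)"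
    unfolding poly_endo_eq_0_iff_pure[OF \<Psi>(1)] cubic
  proof safe
    fix x y assume "\<forall>x y. (B x y + B y x) \<otimes>\<^sub>C e + e \<otimes>\<^sub>C (B x y + B y x) = 0"
    \<comment> \<open>Since \<open>\<phi>\<close> vanishes on brackets and is 1 on \<open>e\<close>,
      contraction keeps the first summand and kills the second.\<close>
    then have "?\<kappa> ((B x y + B y x) \<otimes>\<^sub>C e + e \<otimes>\<^sub>C (B x y + B y x)) = 0"
      by simp
    then have "B x y + B y x = 0"
      by (simp add: clinear_add[OF \<phi>(1)])
    then show "B x y = - B y x"
      by (simp add: eq_neg_iff_add_eq_0)
  next
    fix x y assume "\<forall>x y. B x y = - B y x"
    then have "B x y + B y x = 0"
      by (simp add: eq_neg_iff_add_eq_0)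
    then show "(B x y + B y x) \<otimes>\<^sub>C e + e \<otimes>\<^sub>C (B x y + B y x) = 0"
      by simp
  qed
  have degree: "(\<forall>q. q \<noteq> 0 \<and> (\<forall>t. poly_endo q \<Psi> t = 0) \<longrightarrow> 3 \<le> degree q) \<longleftrightarrow> (\<exists>x y. B x y \<noteq> 0)"
  proof
    assume min: "\<forall>q. q \<noteq> 0 \<and> (\<forall>t. poly_endo q \<Psi> t = 0) \<longrightarrow> 3 \<le> degree q"
    show "\<exists>x y. B x y \<noteq> 0"
    proof (rule ccontr)
      assume "\<not> (\<exists>x y. B x y \<noteq> 0)"
      \<comment> \<open>Without a bracket \<open>\<Psi>\<close> is the flip, an involution, so a
        polynomial of degree 2 already annihilates it.\<close>
      then have "\<forall>x y. poly_endo [:-1, 0, 1:] \<Psi> (x \<otimes>\<^sub>C y) = 0"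
        by (simp add: poly_endo_deg_le_2 numeral_2_eq_2)
      with min have "3 \<le> degree [:-1, 0, 1 :: complex:]"
        unfolding poly_endo_eq_0_iff_pure[OF \<Psi>(1), symmetric]
        by (metis pCons_eq_0_iff one_neq_zero)
      then show False by simp
    qed
  next
    assume "\<exists>x y. B x y \<noteq> 0"
    then obtain u v where uv: "B u v \<noteq> 0" by blast
    show "\<forall>q. q \<noteq> 0 \<and> (\<forall>t. poly_endo q \<Psi> t = 0) \<longrightarrow> 3 \<le> degree q"
    proof (intro allI impI, elim conjE, rule ccontr)
      fix q :: "complex poly"
      assume q: "q \<noteq> 0" "\<forall>t. poly_endo q \<Psi> t = 0" "\<not> 3 \<le> degree q"
      then have deg: "degree q \<le> 2" by simp
      have ann: "?\<kappa> (coeff q 0 *\<^sub>C t + coeff q 1 *\<^sub>C \<Psi> t + coeff q 2 *\<^sub>C \<Psi> (\<Psi> t)) = 0" for t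
        using q(2) unfolding poly_endo_deg_le_2[OF deg] by (simp only: \<kappa>(4))
      \<comment> \<open>On \<open>e \<otimes>\<^sub>C B u v\<close> the map acts as the flip.
        Contraction kills this tensor and sends its flip to \<open>B u v\<close>, which isolates the
        linear coefficient.\<close>
      have 1: "coeff q 1 = 0"
        using ann[of "e \<otimes>\<^sub>C B u v"] uv by simp
      have e: "e \<noteq> 0"
        using \<phi>(2) clinear_0[OF \<phi>(1)] by (metis zero_neq_one)
      \<comment> \<open>\<open>e \<otimes>\<^sub>C e\<close> is fixed by
        \<open>\<Psi>\<close>.\<close>
      have "(coeff q 0 + coeff q 2) *\<^sub>C e = 0"
        using ann[of "e \<otimes>\<^sub>C e"] 1 by (simp add: scaleC_add_left)
      then have 02: "coeff q 0 + coeff q 2 = 0"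
        using e by simp
      \<comment> \<open>The reversed order \<open>v \<otimes>\<^sub>C u\<close> makes the square of
        \<open>\<Psi>\<close> produce \<open>B u v \<otimes>\<^sub>C e\<close>, whose contraction is
        non-zero.\<close>
      have "?\<kappa> (coeff q 0 *\<^sub>C (v \<otimes>\<^sub>C u) + coeff q 2 *\<^sub>C (v \<otimes>\<^sub>C u + B u v \<otimes>\<^sub>C e + e \<otimes>\<^sub>C B v u)) = 0"
        using ann[of "v \<otimes>\<^sub>C u"] 1 unfolding \<Psi>2 by simp
      then have "(coeff q 0 + coeff q 2) *\<^sub>C \<phi> u *\<^sub>C v + coeff q 2 *\<^sub>C B u v = 0"
        by (simp add: scaleC_add_left scaleC_add_right distrib_right add_ac)
      then have 2: "coeff q 2 = 0"
        using 02 uv by simp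
      have "coeff q i = 0" for i
      proof (cases "i \<le> 2")
        case True
        then have "i = 0 \<or> i = 1 \<or> i = 2" by auto
        then show ?thesis using 1 2 02 by auto
      qed (use deg in \<open>simp add: coeff_eq_0\<close>)
      then show False
        using q(1) by (simp add: poly_eq_iff)
    qed
  qed
  have "degree [:-1, -1, 1, 1 :: complex:] = 3" "lead_coeff [:-1, -1, 1, 1 :: complex:] = 1"
    by simp_all
  then show ?thesis
    unfolding is_minimal_poly_def annihilates using degree by metis
qed


section \<open>The extended bracket\<close>

text \<open>Expand both arguments along the direct sum: the three products involving
  \<open>(1, 0)\<close> are merely flipped, and only the product of the two \<open>g\<close>
  components adds a bracket.\<close>

lemma bracket_map_pure:
  fixes br :: "('g::complex_vector, 'g) tensor \<Rightarrow> 'g"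
  assumes "bracket_map br \<Psi>"
  shows "\<Psi> (x \<otimes>\<^sub>C y) = y \<otimes>\<^sub>C x + (0, br (snd x \<otimes>\<^sub>C snd y)) \<otimes>\<^sub>C (1, 0)"
proof -
  have decomp: "p = fst p *\<^sub>C (1, 0) + (0, snd p)" for p :: "complex \<times> 'g"
    by (simp add: prod_eq_iff scaleC_complex_def)
  obtain a c \<xi> \<eta> where xy: "x = a *\<^sub>C (1, 0) + (0, \<xi>)" "y = c *\<^sub>C (1, 0) + (0, \<eta>)"
    using decomp by blast
  then have snd: "snd x = \<xi>" "snd y = \<eta>" by simp_all
  show ?thesis
    \<comment> \<open>The projections are replaced before \<open>x\<close> and \<open>y\<close> are
      expanded, and the pair rules are disabled so that the sums are not merged back into
      pairs.\<close>
    using assms unfolding snd unfolding xy bracket_map_def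
    by (simp add: tensor_pure_simps clinear_iff scaleC_add_right scaleC_scaleC mult.commute add_ac
        del: add_Pair scaleC_Pair)
qed

theorem proposition2p1:
  fixes br :: "('g::complex_vector, 'g) tensor \<Rightarrow> 'g"
    and \<Psi> :: "(complex \<times> 'g, complex \<times> 'g) tensor \<Rightarrow> (complex \<times> 'g, complex \<times> 'g) tensor"
  assumes "clinear br"
    and "bracket_map br \<Psi>"
  shows "(braiding \<Psi> \<longleftrightarrow>
            (\<forall>\<xi> \<eta> \<zeta>. br (\<xi> \<otimes>\<^sub>C br (\<eta> \<otimes>\<^sub>C \<zeta>)) =
               br (br (\<xi> \<otimes>\<^sub>C \<eta>) \<otimes>\<^sub>C \<zeta>) + br (\<eta> \<otimes>\<^sub>C br (\<xi> \<otimes>\<^sub>C \<zeta>)))) \<and>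
         (is_minimal_poly (([:0, 1:] ^ 2 - 1) * ([:0, 1:] + 1)) \<Psi> \<longleftrightarrow>
            br \<noteq> (\<lambda>_. 0) \<and> (\<forall>\<xi> \<eta>. br (\<xi> \<otimes>\<^sub>C \<eta>) = - br (\<eta> \<otimes>\<^sub>C \<xi>)))"
proof
  let ?B = "\<lambda>x y :: complex \<times> 'g. (0 :: complex, br (snd x \<otimes>\<^sub>C snd y))"
  let ?e = "(1, 0) :: complex \<times> 'g"
  have \<Psi>: "clinear \<Psi>" "\<And>x y. \<Psi> (x \<otimes>\<^sub>C y) = y \<otimes>\<^sub>C x + ?B x y \<otimes>\<^sub>C ?e"
    using assms(2)[unfolded bracket_map_def] bracket_map_pure[OF assms(2)] by blast+
  have central: "\<And>x. ?B ?e x = 0" "\<And>x. ?B x ?e = 0"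
    by (simp_all add: clinear_0[OF assms(1)] zero_prod_def)
  have \<phi>: "clinear (fst :: complex \<times> 'g \<Rightarrow> complex)" "fst ?e = 1" "\<And>x y. fst (?B x y) = 0"
    by (simp_all add: clinear_iff)
  show "braiding \<Psi> \<longleftrightarrow>
            (\<forall>\<xi> \<eta> \<zeta>. br (\<xi> \<otimes>\<^sub>C br (\<eta> \<otimes>\<^sub>C \<zeta>)) =
               br (br (\<xi> \<otimes>\<^sub>C \<eta>) \<otimes>\<^sub>C \<zeta>) + br (\<eta> \<otimes>\<^sub>C br (\<xi> \<otimes>\<^sub>C \<zeta>)))"
    \<comment> \<open>\<open>?B\<close> sees only second components, so quantification over pairs
      reduces to quantification over \<open>g\<close>.\<close>
    unfolding braiding_iff_Jacobi[of \<Psi> ?B ?e, OF \<Psi> central \<phi>(1,2)] by simp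
  have poly: "([:0, 1:] ^ 2 - 1) * ([:0, 1:] + 1) = [:-1, -1, 1, 1 :: complex:]"
    by (simp add: power2_eq_square one_pCons)
  \<comment> \<open>A linear map vanishing on all pure tensors is zero.\<close>
  have "br \<noteq> (\<lambda>_. 0) \<longleftrightarrow> (\<exists>\<xi> \<eta>. br (\<xi> \<otimes>\<^sub>C \<eta>) \<noteq> 0)"
    using clinear_tensor_eqI[OF assms(1), of "\<lambda>_. 0"] by (auto simp: clinear_iff)
  then show "is_minimal_poly (([:0, 1:] ^ 2 - 1) * ([:0, 1:] + 1)) \<Psi> \<longleftrightarrow>
            br \<noteq> (\<lambda>_. 0) \<and> (\<forall>\<xi> \<eta>. br (\<xi> \<otimes>\<^sub>C \<eta>) = - br (\<eta> \<otimes>\<^sub>C \<xi>))"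
    unfolding poly minimal_poly_iff_antisymmetric[of \<Psi> ?B ?e, OF \<Psi> central \<phi>]
    by (simp add: zero_prod_def)
qed

end
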